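(* Let $P$ be a path, and let $U,W$ be graphons. Then for every bounded linear operator $S\colon L_2[0,1]\to L_2[0,1]$ with $S(\mathbf{1})=\mathbf{1}$ and $S^*(\mathbf{1})=\mathbf{1}$, $$\lvert t(P,U)-t(P,W)\rvert\le \mathsf{e}(P)\cdot\sup_{f,g\colon[0,1]\to[0,1]}\lvert\langle f,(T_U\circ S-S\circ T_W)g\rangle\rvert,$$ where the supremum is over measurable $f,g$ and $\mathsf{e}(P)$ is the number of edges of $P$.
   Context: A graphon is a symmetric measurable $W\colon[0,1]^2\to[0,1]$; $T_W\colon L_2[0,1]\to L_2[0,1]$ is $(T_Wf)(x)=\int_{[0,1]}W(x,y)f(y)\,dy$ (real $L_2$, Lebesgue measure, $\langle f,g\rangle=\int fg$). For a finite simple graph $F$, $t(F,W)=\int_{[0,1]^{V(F)}}\prod_{ij\in E(F)}W(x_i,x_j)\prod_{i\in V(F)}dx_i$. $\mathbf{1}$ is the constant one function and $S^*$ the Hilbert adjoint of $S$. *)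

theory Defs
  imports "HOL-Analysis.Analysis"
begin

section \<open>The real Hilbert space \<open>L\<^sub>2[0,1]\<close>\<close>

text \<open>Functions on \<open>[0,1]\<close> are represented by total functions on the reals; their values
  outside \<open>[0,1]\<close> never matter, because the underlying measure lives on \<open>[0,1]\<close>.\<close>

abbreviation unit_leb :: "real measure" where
  "unit_leb \<equiv> lebesgue_on {0..1}"

definition sq_integrable :: "(real \<Rightarrow> real) \<Rightarrow> bool" where
  "sq_integrable f \<longleftrightarrow> f \<in> borel_measurable unit_leb \<and> integrable unit_leb (\<lambda>x. (f x)\<^sup>2)"

lemma sq_integrable_zero [simp]: "sq_integrable (\<lambda>x. 0)"
  by (simp add: sq_integrable_def)

lemma sq_integrable_scale: "sq_integrable f \<Longrightarrow> sq_integrable (\<lambda>x. c * f x)"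
  by (auto simp: sq_integrable_def power_mult_distrib)

lemma sq_integrable_mult:
  assumes "sq_integrable f" "sq_integrable g"
  shows "integrable unit_leb (\<lambda>x. f x * g x)"
proof (rule Bochner_Integration.integrable_bound)
  show "integrable unit_leb (\<lambda>x. (f x)\<^sup>2 + (g x)\<^sup>2)"
    using assms by (auto simp: sq_integrable_def)
  show "(\<lambda>x. f x * g x) \<in> borel_measurable unit_leb"
    using assms by (auto simp: sq_integrable_def)
  have "\<bar>a * b\<bar> \<le> a\<^sup>2 + b\<^sup>2" for a b :: real
  proof -
    have "2 * (\<bar>a\<bar> * \<bar>b\<bar>) \<le> a\<^sup>2 + b\<^sup>2"
      using sum_squares_bound[of "\<bar>a\<bar>" "\<bar>b\<bar>"] by (simp add: mult.assoc)
    moreover have "0 \<le> \<bar>a\<bar> * \<bar>b\<bar>" by simp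
    ultimately show ?thesis unfolding abs_mult by linarith
  qed
  then show "AE x in unit_leb. norm (f x * g x) \<le> norm ((f x)\<^sup>2 + (g x)\<^sup>2)"
    by simp
qed

lemma sq_integrable_add:
  assumes "sq_integrable f" "sq_integrable g"
  shows "sq_integrable (\<lambda>x. f x + g x)"
proof -
  have "integrable unit_leb (\<lambda>x. (f x)\<^sup>2 + (g x)\<^sup>2 + 2 * (f x * g x))"
    using assms sq_integrable_mult[OF assms] by (auto simp: sq_integrable_def)
  then show ?thesis
    using assms by (auto simp: sq_integrable_def power2_sum mult.assoc)
qed

definition l2_rel :: "(real \<Rightarrow> real) \<Rightarrow> (real \<Rightarrow> real) \<Rightarrow> bool" where
  "l2_rel f g \<longleftrightarrow> sq_integrable f \<and> sq_integrable g \<and> (AE x in unit_leb. f x = g x)"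

quotient_type l2 = "real \<Rightarrow> real" / partial: l2_rel
  morphisms rep_l2 l2_of
proof (rule part_equivpI)
  show "\<exists>f. l2_rel f f" by (rule exI[of _ "\<lambda>x. 0"]) (simp add: l2_rel_def)
  show "symp l2_rel" by (auto intro!: sympI simp: l2_rel_def)
  show "transp l2_rel"
  proof (rule transpI)
    fix f g h assume *: "l2_rel f g" "l2_rel g h"
    then have "AE x in unit_leb. f x = g x" "AE x in unit_leb. g x = h x"
      by (auto simp: l2_rel_def)
    then have "AE x in unit_leb. f x = h x" by eventually_elim simp
    with * show "l2_rel f h" by (simp add: l2_rel_def)
  qed
qed

instantiation l2 :: real_vector
begin

lift_definition zero_l2 :: l2 is "\<lambda>x. 0"
  by (simp add: l2_rel_def)

lift_definition plus_l2 :: "l2 \<Rightarrow> l2 \<Rightarrow> l2" is "\<lambda>f g x. f x + g x"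
  by (auto simp: l2_rel_def intro: sq_integrable_add)

lift_definition scaleR_l2 :: "real \<Rightarrow> l2 \<Rightarrow> l2" is "\<lambda>c f x. c * f x"
  by (auto simp: l2_rel_def intro: sq_integrable_scale)

definition uminus_l2 :: "l2 \<Rightarrow> l2" where "uminus_l2 f = (-1) *\<^sub>R f"

definition minus_l2 :: "l2 \<Rightarrow> l2 \<Rightarrow> l2" where "minus_l2 f g = f + (- g)"

instance
proof
  fix a b c :: l2 and r s :: real
  show "a + b + c = a + (b + c)"
    by transfer (auto simp: l2_rel_def add.assoc intro!: sq_integrable_add)
  show "a + b = b + a"
    by transfer (auto simp: l2_rel_def add.commute intro!: sq_integrable_add)
  show "0 + a = a"
    by transfer (auto simp: l2_rel_def)
  show "- a + a = 0"
    unfolding uminus_l2_def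
    by transfer (auto simp: l2_rel_def intro!: sq_integrable_add sq_integrable_scale)
  show "a - b = a + - b"
    by (simp add: minus_l2_def)
  show "r *\<^sub>R (a + b) = r *\<^sub>R a + r *\<^sub>R b"
    by transfer
      (auto simp: l2_rel_def distrib_left intro!: sq_integrable_add sq_integrable_scale)
  show "(r + s) *\<^sub>R a = r *\<^sub>R a + s *\<^sub>R a"
    by transfer
      (auto simp: l2_rel_def distrib_right intro!: sq_integrable_add sq_integrable_scale)
  show "r *\<^sub>R s *\<^sub>R a = (r * s) *\<^sub>R a"
    by transfer (auto simp: l2_rel_def mult.assoc intro!: sq_integrable_scale)
  show "1 *\<^sub>R a = a"
    by transfer (auto simp: l2_rel_def)
qed

end

instantiation l2 :: real_inner
begin

lift_definition inner_l2 :: "l2 \<Rightarrow> l2 \<Rightarrow> real" is "\<lambda>f g. LINT x|unit_leb. f x * g x"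
proof -
  fix f f' g g' assume *: "l2_rel f f'" "l2_rel g g'"
  then have "AE x in unit_leb. f x = f' x" "AE x in unit_leb. g x = g' x"
    by (auto simp: l2_rel_def)
  then have "AE x in unit_leb. f x * g x = f' x * g' x" by eventually_elim simp
  moreover have "integrable unit_leb (\<lambda>x. f x * g x)" "integrable unit_leb (\<lambda>x. f' x * g' x)"
    using * by (auto simp: l2_rel_def intro: sq_integrable_mult)
  ultimately show "(LINT x|unit_leb. f x * g x) = (LINT x|unit_leb. f' x * g' x)"
    by (intro integral_cong_AE) (auto dest: borel_measurable_integrable)
qed

definition norm_l2 :: "l2 \<Rightarrow> real" where "norm_l2 f = sqrt (f \<bullet> f)"

definition sgn_l2 :: "l2 \<Rightarrow> l2" where "sgn_l2 f = f /\<^sub>R norm f"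

definition dist_l2 :: "l2 \<Rightarrow> l2 \<Rightarrow> real" where "dist_l2 f g = norm (f - g)"

definition uniformity_l2 :: "(l2 \<times> l2) filter" where
  "uniformity_l2 = (INF e\<in>{0<..}. principal {(f, g). dist f g < e})"

definition open_l2 :: "l2 set \<Rightarrow> bool" where
  "open_l2 A \<longleftrightarrow> (\<forall>f\<in>A. eventually (\<lambda>(f', g). f' = f \<longrightarrow> g \<in> A) uniformity)"

instance
proof
  fix a b c :: l2 and r :: real and A :: "l2 set"
  show "dist a b = norm (a - b)" by (simp add: dist_l2_def)
  show "sgn a = a /\<^sub>R norm a" by (simp add: sgn_l2_def)
  show "(uniformity :: (l2 \<times> l2) filter) = (INF e\<in>{0<..}. principal {(f, g). dist f g < e})"
    by (simp add: uniformity_l2_def)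
  show "open A \<longleftrightarrow> (\<forall>f\<in>A. \<forall>\<^sub>F (f', g) in uniformity. f' = f \<longrightarrow> g \<in> A)"
    by (simp add: open_l2_def)
  show "norm a = sqrt (a \<bullet> a)" by (simp add: norm_l2_def)
  show "a \<bullet> b = b \<bullet> a"
    by transfer (simp add: mult.commute)
  show "(a + b) \<bullet> c = a \<bullet> c + b \<bullet> c"
    by transfer (auto simp: l2_rel_def distrib_right
        intro!: Bochner_Integration.integral_add sq_integrable_mult)
  show "r *\<^sub>R a \<bullet> b = r * (a \<bullet> b)"
    by transfer (simp add: mult.assoc)
  show "0 \<le> a \<bullet> a"
    by transfer simp
  show "a \<bullet> a = 0 \<longleftrightarrow> a = 0"
  proof transfer
    fix f assume "l2_rel f f"
    then have f: "sq_integrable f" by (simp add: l2_rel_def)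
    have "(LINT x|unit_leb. f x * f x) = 0 \<longleftrightarrow> (AE x in unit_leb. f x * f x = 0)"
      by (intro integral_nonneg_eq_0_iff_AE sq_integrable_mult f) auto
    then show "(LINT x|unit_leb. f x * f x) = 0 \<longleftrightarrow> l2_rel f (\<lambda>x. 0)"
      using f by (simp add: l2_rel_def)
  qed
qed

end


section \<open>Graphons and their kernel operators\<close>

definition graphon :: "(real \<Rightarrow> real \<Rightarrow> real) \<Rightarrow> bool" where
  "graphon W \<longleftrightarrow>
     (\<lambda>(x, y). W x y) \<in> borel_measurable (lebesgue_on ({0..1} \<times> {0..1})) \<and>
     (\<forall>x\<in>{0..1}. \<forall>y\<in>{0..1}. W x y = W y x \<and> 0 \<le> W x y \<and> W x y \<le> 1)"

text \<open>The integral does not depend on the chosen representative of \<open>f\<close>.  For a graphon, almost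
  every section \<open>W x\<close> is Lebesgue measurable, and the resulting function of \<open>x\<close> is
  square-integrable.\<close>

definition graphon_op :: "(real \<Rightarrow> real \<Rightarrow> real) \<Rightarrow> l2 \<Rightarrow> l2" where
  "graphon_op W f = l2_of (\<lambda>x. LINT y|unit_leb. W x y * rep_l2 f y)"

definition unit_funs :: "(real \<Rightarrow> real) set" where
  "unit_funs = {f \<in> borel_measurable unit_leb. \<forall>x\<in>{0..1}. 0 \<le> f x \<and> f x \<le> 1}"


section \<open>Finite simple graphs and homomorphism densities\<close>

definition simple_graph :: "'v set \<Rightarrow> 'v set set \<Rightarrow> bool" where
  "simple_graph V E \<longleftrightarrow> finite V \<and> (\<forall>e\<in>E. e \<subseteq> V \<and> card e = 2)"

definition path_graph :: "'v set \<Rightarrow> 'v set set \<Rightarrow> bool" where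
  "path_graph V E \<longleftrightarrow> simple_graph V E \<and>
     (\<exists>vs. vs \<noteq> [] \<and> distinct vs \<and> set vs = V \<and>
           E = {{vs ! i, vs ! Suc i} | i. Suc i < length vs})"

text \<open>For an edge \<open>e = {i, j}\<close> this is \<open>W (x i) (x j)\<close>; by the symmetry of \<open>W\<close> on \<open>[0,1]\<^sup>2\<close> the
  order of the endpoints is irrelevant when \<open>x i\<close> and \<open>x j\<close> lie in \<open>[0,1]\<close>.\<close>

definition edge_weight :: "(real \<Rightarrow> real \<Rightarrow> real) \<Rightarrow> ('v \<Rightarrow> real) \<Rightarrow> 'v set \<Rightarrow> real" where
  "edge_weight W x e = (THE w. \<exists>i j. e = {i, j} \<and> i \<noteq> j \<and> w = W (x i) (x j))"

text \<open>Since \<open>W\<close> is only Lebesgue measurable, the integrand is measurable with respect to Lebesgue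
  measure on \<open>[0,1]\<^sup>V\<close>, that is, the completion of the product measure, but possibly not with
  respect to the product measure itself.\<close>

definition hom_density ::
  "'v set \<Rightarrow> 'v set set \<Rightarrow> (real \<Rightarrow> real \<Rightarrow> real) \<Rightarrow> real" where
  "hom_density V E W =
     (LINT x|completion (\<Pi>\<^sub>M i\<in>V. unit_leb). (\<Prod>e\<in>E. edge_weight W x e))"

end

theory Submission
  imports Defs
begin

text \<open>For a path with \<open>k\<close> edges, \<open>t(P, W) = \<langle>1, T\<^sub>W\<^sup>k 1\<rangle>\<close>.  Since \<open>S\<close> and its adjoint fix \<open>1\<close>, the
  difference \<open>t(P, U) - t(P, W)\<close> equals
  \<open>\<langle>T\<^sub>U\<^sup>k 1, S 1\<rangle> - \<langle>1, S T\<^sub>W\<^sup>k 1\<rangle>\<close>, which telescopes into \<open>k\<close> terms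
  \<open>\<langle>T\<^sub>U\<^sup>i 1, (T\<^sub>U S - S T\<^sub>W) T\<^sub>W\<^sup>j 1\<rangle>\<close>; the iterates of \<open>1\<close> are \<open>[0,1]\<close>-valued, so each term is
  bounded by the supremum.

  The library's \<open>adjoint\<close> is a choice operator, so its defining property must be derived from the
  Riesz representation theorem, and hence from the completeness of \<open>l2\<close>.  Measurability is handled by
  replacing a Lebesgue measurable graphon with a symmetric Borel kernel that agrees with it almost
  everywhere.\<close>

section \<open>Riesz representation\<close>

text \<open>The linear parts cancel at the midpoint, so only the parallelogram identity for the
  quadratic part remains.\<close>

lemma parallelogram_functional:
  fixes x y :: "'a::real_inner"
  assumes "linear \<phi>"
  defines "J \<equiv> \<lambda>x. x \<bullet> x - 2 * \<phi> x"
  shows "(norm (x - y))\<^sup>2 = 2 * (J x + J y - 2 * J ((1/2) *\<^sub>R (x + y)))"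
  unfolding J_def power2_norm_eq_inner
  by (simp add: linear_add[OF assms(1)] linear_scale[OF assms(1)] inner_add_left inner_add_right
      inner_diff_left inner_diff_right inner_commute field_simps)

text \<open>The representing vector is the minimiser of \<open>x \<bullet> x - 2 * \<phi> x\<close>; minimising sequences are Cauchy
  by the parallelogram law.\<close>

lemma riesz_representation:
  fixes \<phi> :: "'a::{real_inner, complete_space} \<Rightarrow> real"
  assumes "bounded_linear \<phi>"
  obtains z where "\<And>x. \<phi> x = z \<bullet> x"
proof -
  interpret \<phi>: bounded_linear \<phi> by fact
  define J where "J x = x \<bullet> x - 2 * \<phi> x" for x
  obtain C where C: "norm (\<phi> x) \<le> norm x * C" for x
    using \<phi>.bounded by blast
  \<comment> \<open>Completing the square: the lower bound for \<open>J x\<close> equals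
    \<open>(norm x - C)\<^sup>2 - C\<^sup>2\<close>.\<close>
  have J_ge: "- C\<^sup>2 \<le> J x" for x
  proof -
    have "J x \<ge> (norm x)\<^sup>2 - 2 * (norm x * C)"
      using C[of x] by (simp add: J_def power2_norm_eq_inner)
    moreover have "(norm x - C)\<^sup>2 \<ge> 0" by simp
    ultimately show ?thesis by (simp add: power2_diff algebra_simps)
  qed
  have bdd: "bdd_below (range J)"
    using J_ge by (intro bdd_belowI[of _ "- C\<^sup>2"]) auto
  define d where "d = Inf (range J)"
  have d_le: "d \<le> J x" for x
    unfolding d_def using bdd by (intro cInf_lower) auto
  have "\<exists>x. J x < d + 1 / real (Suc n)" for n
    using cInf_lessD[of "range J" "d + 1 / real (Suc n)"] by (auto simp: d_def)
  then obtain X where X: "J (X n) < d + 1 / real (Suc n)" for n by metis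
  \<comment> \<open>Both values lie within their margins of the infimum \<open>d\<close>, and the
    midpoint value is at least \<open>d\<close>.\<close>
  have near: "(norm (X m - X n))\<^sup>2 \<le> 2 * (1 / real (Suc m) + 1 / real (Suc n))" for m n
    using parallelogram_functional[OF \<phi>.linear, of "X m" "X n"]
      d_le[of "(1/2) *\<^sub>R (X m + X n)"] X[of m] X[of n]
    unfolding J_def by argo
  have "Cauchy X"
  proof (rule metric_CauchyI)
    fix e :: real assume "e > 0"
    then obtain N where N: "1 / real (Suc N) < e\<^sup>2 / 4"
      using reals_Archimedean[of "e\<^sup>2 / 4"] by (auto simp: inverse_eq_divide)
    have "dist (X m) (X n) < e" if "m \<ge> N" "n \<ge> N" for m n
    proof -
      have "1 / real (Suc m) \<le> 1 / real (Suc N)" "1 / real (Suc n) \<le> 1 / real (Suc N)"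
        using that by (auto simp: frac_le)
      with near[of m n] N have "(norm (X m - X n))\<^sup>2 < e\<^sup>2" by argo
      then show ?thesis using \<open>e > 0\<close> by (simp add: dist_norm power_less_imp_less_base)
    qed
    then show "\<exists>M. \<forall>m\<ge>M. \<forall>n\<ge>M. dist (X m) (X n) < e" by blast
  qed
  then obtain z where z: "X \<longlonglongrightarrow> z"
    using Cauchy_convergent convergent_def by blast
  have "(\<lambda>n. J (X n)) \<longlonglongrightarrow> J z"
    unfolding J_def by (intro tendsto_intros z \<phi>.tendsto)
  moreover have "(\<lambda>n. d + 1 / real (Suc n)) \<longlonglongrightarrow> d + 0"
    by (intro tendsto_intros LIMSEQ_Suc lim_1_over_n)
  ultimately have "J z \<le> d"
    using X by (intro LIMSEQ_le[of "\<lambda>n. J (X n)" _ "\<lambda>n. d + 1 / real (Suc n)"])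
      (auto intro: less_imp_le)
  then have min: "J z \<le> J x" for x using d_le[of x] by linarith
  show ?thesis
  proof (rule that[of z])
    fix v
    define c where "c = z \<bullet> v - \<phi> v"
    have quad: "0 \<le> t * (t * (v \<bullet> v) + 2 * c)" for t
      using min[of "z + t *\<^sub>R v"]
      by (simp add: J_def c_def \<phi>.add \<phi>.scaleR inner_add_left inner_add_right
          inner_commute algebra_simps)
    have "c = 0"
    proof (rule ccontr)
      assume "c \<noteq> 0"
      \<comment> \<open>The quadratic in \<open>t\<close> is least at
        \<open>- c / (v \<bullet> v)\<close>; the added 1 keeps the denominator positive even for
        \<open>v = 0\<close>, and the value is still negative.\<close>
      define t where "t = - c / (1 + v \<bullet> v)"
      have p: "1 + v \<bullet> v > 0" by (simp add: add_pos_nonneg)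
      have tD: "t * (1 + v \<bullet> v) = - c" using p by (simp add: t_def)
      have "0 \<le> (1 + v \<bullet> v)\<^sup>2 * (t * (t * (v \<bullet> v) + 2 * c))"
        using mult_nonneg_nonneg[OF zero_le_power2 quad] .
      also have "\<dots> = (t * (1 + v \<bullet> v)) * ((t * (1 + v \<bullet> v)) * (v \<bullet> v) + 2 * c * (1 + v \<bullet> v))"
        by algebra
      also have "\<dots> = - (c\<^sup>2 * (2 + v \<bullet> v))"
        unfolding tD by algebra
      also have "\<dots> < 0"
        using \<open>c \<noteq> 0\<close> by (simp add: add_pos_nonneg)
      finally show False by simp
    qed
    then show "\<phi> v = z \<bullet> v" by (simp add: c_def)
  qed
qed

text \<open>\<open>adjoint S\<close> is chosen among the maps satisfying the identity for all
  arguments, so one such map must exist. Riesz, applied to each functional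
  \<open>\<lambda>x. S x \<bullet> y\<close>, provides its values.\<close>

lemma bounded_linear_adjoint_works:
  fixes S :: "'a::{real_inner, complete_space} \<Rightarrow> 'b::real_inner"
  assumes "bounded_linear S"
  shows "x \<bullet> adjoint S y = S x \<bullet> y"
proof -
  have "\<exists>z. \<forall>x. S x \<bullet> y = x \<bullet> z" for y
  proof -
    have "bounded_linear (\<lambda>x. S x \<bullet> y)"
      using bounded_linear_compose[OF bounded_linear_inner_left assms] .
    then obtain z where "\<And>x. S x \<bullet> y = z \<bullet> x"
      using riesz_representation by blast
    then show ?thesis by (metis inner_commute)
  qed
  then have "\<exists>S'. \<forall>x y. S x \<bullet> y = x \<bullet> S' y" by metis
  then have "\<forall>x y. S x \<bullet> y = x \<bullet> adjoint S y"
    unfolding adjoint_def by (rule someI_ex)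
  then show ?thesis by simp
qed


section \<open>Completeness of the space of square-integrable functions\<close>

lemma rep_l2_sq_integrable [simp]: "sq_integrable (rep_l2 a)"
  using Quotient_rep_reflp[OF Quotient_l2, of a] by (simp add: l2_rel_def)

lemma l2_of_rep_l2 [simp]: "l2_of (rep_l2 a) = a"
  by (rule Quotient_abs_rep[OF Quotient_l2])

lemma l2_of_eqI:
  assumes "sq_integrable f" "sq_integrable g" "AE x in unit_leb. f x = g x"
  shows "l2_of f = l2_of g"
  using assms by (intro Quotient_rel_abs[OF Quotient_l2]) (simp add: l2_rel_def)

lemma rep_l2_of_AE:
  assumes "sq_integrable f"
  shows "AE x in unit_leb. rep_l2 (l2_of f) x = f x"
  using Quotient_rep_abs[OF Quotient_l2, of f] assms by (simp add: l2_rel_def)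

lemma inner_l2_of:
  assumes "sq_integrable f" "sq_integrable g"
  shows "l2_of f \<bullet> l2_of g = (LINT x|unit_leb. f x * g x)"
  using assms by (simp add: inner_l2.abs_eq l2_rel_def)

lemma sq_integrable_diff:
  assumes "sq_integrable f" "sq_integrable g"
  shows "sq_integrable (\<lambda>x. f x - g x)"
  using sq_integrable_add[OF assms(1) sq_integrable_scale[OF assms(2), of "-1"]] by simp

lemma diff_l2_of:
  assumes "sq_integrable f" "sq_integrable g"
  shows "l2_of f - l2_of g = l2_of (\<lambda>x. f x - g x)"
proof -
  have "l2_rel (\<lambda>x. -1 * g x) (\<lambda>x. -1 * g x)"
    using sq_integrable_scale[OF assms(2), of "-1"] unfolding l2_rel_def by blast
  moreover have "l2_rel f f" "l2_rel g g"
    using assms by (simp_all add: l2_rel_def)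
  ultimately have "l2_of f + (-1) *\<^sub>R l2_of g = l2_of (\<lambda>x. f x + -1 * g x)"
    by (simp only: plus_l2.abs_eq scaleR_l2.abs_eq)
  then show ?thesis
    unfolding minus_l2_def uminus_l2_def by simp
qed

lemma norm_diff_l2_of:
  assumes "sq_integrable f" "sq_integrable g"
  shows "(norm (l2_of f - l2_of g))\<^sup>2 = (LINT x|unit_leb. (f x - g x)\<^sup>2)"
  unfolding diff_l2_of[OF assms] power2_norm_eq_inner
    inner_l2_of[OF sq_integrable_diff[OF assms] sq_integrable_diff[OF assms]]
  by (simp only: power2_eq_square)

lemma nn_integral_sq:
  assumes "sq_integrable f"
  shows "(\<integral>\<^sup>+x. ennreal ((f x)\<^sup>2) \<partial>unit_leb) = ennreal (LINT x|unit_leb. (f x)\<^sup>2)"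
  using assms by (intro nn_integral_eq_integral) (auto simp: sq_integrable_def)

text \<open>The increments squared and weighted by \<open>2\<^sup>n\<close> still have summable integrals, and by AM-GM they
  dominate the increments themselves up to a geometric series.\<close>

lemma AE_convergent_fast_L2:
  fixes f :: "nat \<Rightarrow> real \<Rightarrow> real"
  assumes f: "\<And>n. sq_integrable (f n)"
    and fast: "\<And>n. (LINT x|unit_leb. (f (Suc n) x - f n x)\<^sup>2) \<le> (1/4)^n"
  shows "AE x in unit_leb. convergent (\<lambda>n. f n x)"
proof -
  define d where "d n x = f (Suc n) x - f n x" for n x
  have d: "sq_integrable (d n)" for n
    using sq_integrable_diff[OF f f] by (simp add: d_def[abs_def])
  then have [measurable]: "d n \<in> borel_measurable unit_leb" for n
    by (simp add: sq_integrable_def)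
  have "(\<integral>\<^sup>+x. (\<Sum>n. ennreal (2^n * (d n x)\<^sup>2)) \<partial>unit_leb)
      = (\<Sum>n. \<integral>\<^sup>+x. ennreal (2^n * (d n x)\<^sup>2) \<partial>unit_leb)"
    by (intro nn_integral_suminf) measurable
  also have "\<dots> \<le> (\<Sum>n. ennreal ((1/2)^n))"
  proof (intro suminf_le summableI)
    fix n
    have "(\<integral>\<^sup>+x. ennreal (2^n * (d n x)\<^sup>2) \<partial>unit_leb)
        = ennreal (2^n) * (\<integral>\<^sup>+x. ennreal ((d n x)\<^sup>2) \<partial>unit_leb)"
      by (simp add: ennreal_mult nn_integral_cmult)
    also have "\<dots> \<le> ennreal (2^n) * ennreal ((1/4)^n)"
      unfolding nn_integral_sq[OF d]
      by (rule mult_left_mono[OF ennreal_leI[OF fast[of n, folded d_def]]]) simp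
    also have "\<dots> = ennreal ((1/2)^n)"
      using power_mult_distrib[of 2 "1/4::real" n] by (subst ennreal_mult[symmetric]) auto
    finally show "(\<integral>\<^sup>+x. ennreal (2^n * (d n x)\<^sup>2) \<partial>unit_leb) \<le> ennreal ((1/2)^n)" .
  qed
  also have "\<dots> = ennreal (\<Sum>n. (1/2)^n)"
    by (rule suminf_ennreal2) (auto intro: summable_geometric)
  also have "\<dots> < \<infinity>"
    by (simp only: infinity_ennreal_def ennreal_less_top)
  finally have "AE x in unit_leb. (\<Sum>n. ennreal (2^n * (d n x)\<^sup>2)) \<noteq> \<infinity>"
    by (intro nn_integral_PInf_AE) auto
  then show ?thesis
  proof eventually_elim
    case (elim x)
    then have s: "summable (\<lambda>n. 2^n * (d n x)\<^sup>2)"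
      by (intro summable_suminf_not_top) (auto simp: infinity_ennreal_def)
    have amgm: "\<bar>d n x\<bar> \<le> 2^n * (d n x)\<^sup>2 + (1/2)^n" for n
    proof -
      define a b :: real where "a = 2^n" and "b = (1/2)^n"
      have ab: "a * b = 1" "a > 0" "b > 0"
        by (simp_all add: a_def b_def flip: power_mult_distrib)
      have "0 \<le> a * (\<bar>d n x\<bar> - b)\<^sup>2" using ab by simp
      also have "\<dots> = a * \<bar>d n x\<bar>\<^sup>2 - 2 * \<bar>d n x\<bar> + b"
        using ab(1) by algebra
      finally have "2 * \<bar>d n x\<bar> \<le> a * (d n x)\<^sup>2 + b" by simp
      then show ?thesis
        unfolding a_def[symmetric] b_def[symmetric] using abs_ge_zero[of "d n x"] by linarith
    qed
    have "summable (\<lambda>n. d n x)"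
      by (rule summable_comparison_test'[OF summable_add[OF s summable_geometric[of "1/2::real"]]])
        (use amgm in auto)
    then have "convergent (\<lambda>n. \<Sum>k<n. d k x)"
      by (simp add: summable_iff_convergent)
    then have "convergent (\<lambda>n. f 0 x + (\<Sum>k<n. d k x))"
      by (simp add: convergent_add_const_iff)
    moreover have "f 0 x + (\<Sum>k<n. d k x) = f n x" for n
      by (induction n) (auto simp: d_def)
    ultimately show "convergent (\<lambda>n. f n x)" by simp
  qed
qed

text \<open>The fast increments give a pointwise limit almost everywhere; Fatou's lemma then turns
  the Cauchy condition into mean-square convergence to it.\<close>

lemma riesz_fischer:
  fixes f :: "nat \<Rightarrow> real \<Rightarrow> real"
  assumes f: "\<And>n. sq_integrable (f n)"
    and fast: "\<And>n. (LINT x|unit_leb. (f (Suc n) x - f n x)\<^sup>2) \<le> (1/4)^n"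
    and cauchy: "\<And>e. e > 0 \<Longrightarrow> \<exists>N. \<forall>m\<ge>N. \<forall>n\<ge>N. (LINT x|unit_leb. (f m x - f n x)\<^sup>2) \<le> e"
  obtains g where "sq_integrable g" "(\<lambda>n. LINT x|unit_leb. (f n x - g x)\<^sup>2) \<longlonglongrightarrow> 0"
proof -
  have [measurable]: "f n \<in> borel_measurable unit_leb" for n
    using f[of n] by (simp add: sq_integrable_def)
  \<comment> \<open>Where the sequence diverges, \<open>lim\<close> is an unspecified value; this
    concerns only a null set.\<close>
  define g where "g x = lim (\<lambda>n. f n x)" for x
  have [measurable]: "g \<in> borel_measurable unit_leb"
    unfolding g_def by measurable
  have conv: "AE x in unit_leb. (\<lambda>n. f n x) \<longlonglongrightarrow> g x"
    using AE_convergent_fast_L2[OF f fast]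
    by eventually_elim (simp add: g_def convergent_LIMSEQ_iff)
  \<comment> \<open>Here \<open>n\<close> stays fixed while \<open>m\<close> tends to
    infinity.\<close>
  have fatou: "(\<integral>\<^sup>+x. ennreal ((f n x - g x)\<^sup>2) \<partial>unit_leb) \<le> ennreal e"
    if N: "\<forall>m\<ge>N. \<forall>n\<ge>N. (LINT x|unit_leb. (f m x - f n x)\<^sup>2) \<le> e" and n: "n \<ge> N" for n N e
  proof -
    have "(\<integral>\<^sup>+x. ennreal ((f n x - g x)\<^sup>2) \<partial>unit_leb)
        = (\<integral>\<^sup>+x. liminf (\<lambda>m. ennreal ((f n x - f m x)\<^sup>2)) \<partial>unit_leb)"
    proof (rule nn_integral_cong_AE, use conv in eventually_elim)
      case (elim x)
      have "(\<lambda>m. ennreal ((f n x - f m x)\<^sup>2)) \<longlonglongrightarrow> ennreal ((f n x - g x)\<^sup>2)"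
        by (intro tendsto_intros elim)
      then show "ennreal ((f n x - g x)\<^sup>2) = liminf (\<lambda>m. ennreal ((f n x - f m x)\<^sup>2))"
        by (intro lim_imp_Liminf[symmetric]) simp_all
    qed
    also have "\<dots> \<le> liminf (\<lambda>m. \<integral>\<^sup>+x. ennreal ((f n x - f m x)\<^sup>2) \<partial>unit_leb)"
      by (intro nn_integral_liminf) measurable
    also have "\<dots> \<le> ennreal e"
    proof (rule Liminf_le)
      show "\<forall>\<^sub>F m in sequentially. (\<integral>\<^sup>+x. ennreal ((f n x - f m x)\<^sup>2) \<partial>unit_leb) \<le> ennreal e"
        using eventually_ge_at_top[of N]
        by eventually_elim
          (use N n in \<open>auto simp: nn_integral_sq[OF sq_integrable_diff[OF f f]] intro: ennreal_leI\<close>)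
    qed simp
    finally show ?thesis .
  qed
  have sq: "sq_integrable (\<lambda>x. f n x - g x)" if "\<forall>m\<ge>N. \<forall>n\<ge>N. (LINT x|unit_leb. (f m x - f n x)\<^sup>2) \<le> e" "n \<ge> N" for n N e
    unfolding sq_integrable_def
    using le_less_trans[OF fatou[OF that] ennreal_less_top]
    by (auto intro!: integrableI_nonneg simp: infinity_ennreal_def)
  show ?thesis
  proof
    obtain N where N: "\<forall>m\<ge>N. \<forall>n\<ge>N. (LINT x|unit_leb. (f m x - f n x)\<^sup>2) \<le> 1"
      using cauchy[of 1] by auto
    \<comment> \<open>\<open>g\<close> is \<open>f N - (f N - g)\<close>, a difference of
      square-integrable functions.\<close>
    show "sq_integrable g"
      using sq_integrable_diff[OF f sq[OF N order_refl], of N] by simp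
    show "(\<lambda>n. LINT x|unit_leb. (f n x - g x)\<^sup>2) \<longlonglongrightarrow> 0"
    proof (rule LIMSEQ_I)
      fix r :: real assume r: "0 < r"
      then obtain N where N: "\<forall>m\<ge>N. \<forall>n\<ge>N. (LINT x|unit_leb. (f m x - f n x)\<^sup>2) \<le> r / 2"
        using cauchy[of "r / 2"] by auto
      have "(LINT x|unit_leb. (f n x - g x)\<^sup>2) \<le> r / 2" if "n \<ge> N" for n
        using fatou[OF N that] r by (simp add: nn_integral_sq[OF sq[OF N that]])
      then show "\<exists>no. \<forall>n\<ge>no. norm ((LINT x|unit_leb. (f n x - g x)\<^sup>2) - 0) < r"
        using r by (intro exI[of _ N]) (force simp: abs_of_nonneg)
    qed
  qed
qed

text \<open>A Cauchy sequence converges as soon as a subsequence does, so a subsequence with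
  geometrically small steps is enough.\<close>

instance l2 :: complete_space
proof
  fix X :: "nat \<Rightarrow> l2" assume X: "Cauchy X"
  have "\<forall>n. \<exists>N. \<forall>i\<ge>N. \<forall>j\<ge>N. dist (X i) (X j) < (1/2)^n"
    using metric_CauchyD[OF X] by simp
  then obtain N where N: "dist (X i) (X j) < (1/2)^n" if "i \<ge> N n" "j \<ge> N n" for n i j
    by metis
  \<comment> \<open>The partial sums dominate \<open>N n\<close>, and each \<open>Suc\<close> makes
    them strictly increasing.\<close>
  define r where "r n = (\<Sum>k\<le>n. Suc (N k))" for n
  have r: "strict_mono r" by (simp add: r_def strict_mono_Suc_iff)
  have rN: "N n \<le> r n" for n
    unfolding r_def by (rule order_trans[OF _ member_le_sum[of n]]) auto
  define f where "f n = rep_l2 (X (r n))" for n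
  have [simp]: "sq_integrable (f n)" for n by (simp add: f_def)
  have norm_f: "(LINT x|unit_leb. (f m x - f n x)\<^sup>2) = (dist (X (r m)) (X (r n)))\<^sup>2" for m n
    by (simp add: dist_norm f_def flip: norm_diff_l2_of)
  obtain g where g: "sq_integrable g" "(\<lambda>n. LINT x|unit_leb. (f n x - g x)\<^sup>2) \<longlonglongrightarrow> 0"
  proof (rule riesz_fischer[of f])
    fix n
    have "dist (X (r (Suc n))) (X (r n)) < (1/2)^n"
      using rN[of n] strict_monoD[OF r, of n "Suc n"] by (intro N) auto
    then have "(dist (X (r (Suc n))) (X (r n)))\<^sup>2 \<le> ((1/2)^n)\<^sup>2"
      by (intro power_mono) auto
    also have "((1/2)^n)\<^sup>2 = (1/4 :: real)^n"
      by (simp add: power2_eq_square flip: power_mult_distrib)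
    finally show "(LINT x|unit_leb. (f (Suc n) x - f n x)\<^sup>2) \<le> (1/4)^n"
      by (simp only: norm_f)
  next
    fix e :: real assume "e > 0"
    then obtain M where M: "\<forall>m\<ge>M. \<forall>n\<ge>M. dist (X m) (X n) < sqrt e"
      using metric_CauchyD[OF X, of "sqrt e"] by auto
    have "(dist (X (r m)) (X (r n)))\<^sup>2 \<le> e" if "m \<ge> M" "n \<ge> M" for m n
    proof -
      have "dist (X (r m)) (X (r n)) < sqrt e"
        using M that seq_suble[OF r, of m] seq_suble[OF r, of n] by auto
      then show ?thesis using power_mono[of _ "sqrt e" 2] \<open>e > 0\<close> by fastforce
    qed
    then show "\<exists>N. \<forall>m\<ge>N. \<forall>n\<ge>N. (LINT x|unit_leb. (f m x - f n x)\<^sup>2) \<le> e"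
      unfolding norm_f by blast
  qed auto
  have "(\<lambda>n. (dist (X (r n)) (l2_of g))\<^sup>2) \<longlonglongrightarrow> 0"
    using g norm_diff_l2_of[of "f _" g] by (simp add: dist_norm f_def)
  then have "(X \<circ> r) \<longlonglongrightarrow> l2_of g"
    by (subst tendsto_dist_iff) (simp add: o_def)
  then show "convergent X"
    using Cauchy_converges_subseq[OF X r] by (auto simp: convergent_def)
qed


section \<open>Borel versions of graphons\<close>

text \<open>The two preimages of a set differ by part of a null set, which is measurable by
  completeness. This yields measurability of sections and edge products of a graphon that is merely
  Lebesgue measurable.\<close>

lemma (in complete_measure) measurable_cong_AE:
  assumes f: "f \<in> measurable M N" and g: "g \<in> space M \<rightarrow> space N"
    and eq: "AE x in M. f x = g x"
  shows "g \<in> measurable M N"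
proof (rule measurableI)
  show "g x \<in> space N" if "x \<in> space M" for x using g that by auto
  fix A assume "A \<in> sets N"
  then have A: "f -` A \<inter> space M \<in> sets M" using f by (rule measurable_sets[rotated])
  have "AE x in M. x \<in> f -` A \<inter> space M \<longleftrightarrow> x \<in> g -` A \<inter> space M"
    using eq by eventually_elim auto
  then show "g -` A \<inter> space M \<in> sets M"
    using A by (rule in_sets_AE) auto
qed

section \<open>Measure theory on the unit interval and its powers\<close>

lemma emeasure_space_unit_leb [simp]: "emeasure unit_leb {0..1} = 1"
  by (simp add: emeasure_restrict_space)

interpretation unit_leb: finite_measure unit_leb
  by (rule finite_measureI) simp

interpretation unit_leb: complete_measure unit_leb
proof
  fix A B :: "real set" assume *: "B \<subseteq> A" "A \<in> null_sets unit_leb"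
  then have "A \<in> null_sets lebesgue" "A \<subseteq> {0..1}" by (auto simp: null_sets_restrict_space)
  with * have "B \<in> sets lebesgue" using completion.complete by blast
  with * \<open>A \<subseteq> {0..1}\<close> show "B \<in> sets unit_leb" by (auto simp: sets_restrict_space_iff)
qed

interpretation unit_square: pair_sigma_finite unit_leb unit_leb ..

interpretation unit_cube: product_sigma_finite "\<lambda>_. unit_leb"
  by (rule product_sigma_finite.intro) (rule unit_leb.sigma_finite_measure_axioms)

lemma measurable_ident_unit_leb [measurable]: "(\<lambda>x. x) \<in> borel_measurable unit_leb"
  by (intro measurable_restrict_space1 measurable_completion) simp

lemma sq_integrable_cong_AE:
  assumes "sq_integrable f" "AE x in unit_leb. f x = g x"
  shows "sq_integrable g"
proof -
  have [measurable]: "f \<in> borel_measurable unit_leb"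
    using assms by (simp add: sq_integrable_def)
  have [measurable]: "g \<in> borel_measurable unit_leb"
    using unit_leb.measurable_cong_AE[OF _ _ assms(2)] by simp
  have "AE x in unit_leb. (f x)\<^sup>2 = (g x)\<^sup>2"
    using assms(2) by eventually_elim simp
  then have "integrable unit_leb (\<lambda>x. (g x)\<^sup>2)"
    using assms(1) by (subst integrable_cong_AE[of _ _ "\<lambda>x. (f x)\<^sup>2"]) (auto simp: sq_integrable_def)
  then show ?thesis by (simp add: sq_integrable_def)
qed

lemma sq_integrable_abs: "sq_integrable f \<Longrightarrow> sq_integrable (\<lambda>x. \<bar>f x\<bar>)"
  by (auto simp: sq_integrable_def)

lemma sq_integrable_bounded:
  assumes "f \<in> borel_measurable unit_leb" "\<And>x. x \<in> {0..1} \<Longrightarrow> \<bar>f x\<bar> \<le> C"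
  shows "sq_integrable f"
  unfolding sq_integrable_def
proof
  show "integrable unit_leb (\<lambda>x. (f x)\<^sup>2)"
  proof (rule unit_leb.integrable_const_bound[where B = "C\<^sup>2"])
    show "AE x in unit_leb. norm ((f x)\<^sup>2) \<le> C\<^sup>2"
      using assms(2) by (auto intro!: AE_I2 simp flip: abs_le_square_iff intro: order_trans[OF _ abs_ge_self])
  qed (use assms in simp)
qed (use assms in simp)

lemma sq_integrable_imp_integrable:
  assumes "sq_integrable f" shows "integrable unit_leb f"
  using sq_integrable_mult[OF assms, of "\<lambda>_. 1"] sq_integrable_bounded[of "\<lambda>_. 1" 1] by simp

section \<open>Transfer of null sets from the line and the plane\<close>

lemma AE_lborel_imp_unit_leb: "AE x in lborel. P x \<Longrightarrow> AE x in unit_leb. P x"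
  by (subst AE_restrict_space_iff) (auto dest: AE_completion)

text \<open>Fubini for planar null sets, followed by restriction in each variable
  separately.\<close>

lemma AE_lborel_pair_imp_unit_leb:
  fixes P :: "real \<times> real \<Rightarrow> bool"
  assumes "AE p in lborel. P p"
  shows "AE x in unit_leb. AE y in unit_leb. P (x, y)"
proof -
  have "AE x in lborel. AE y in lborel. P (x, y)"
    by (rule lborel_pair.AE_pair, subst lborel_prod, rule assms)
  then have "AE x in lborel. AE y in unit_leb. P (x, y)"
    by eventually_elim (rule AE_lborel_imp_unit_leb)
  then show ?thesis by (rule AE_lborel_imp_unit_leb)
qed

lemma AE_lborel_pair_swap:
  fixes P :: "real \<times> real \<Rightarrow> bool"
  assumes "AE p in lborel. P p"
  shows "AE p in lborel. P (prod.swap p)"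
proof -
  have "distr (lborel \<Otimes>\<^sub>M lborel) (lborel \<Otimes>\<^sub>M lborel) (\<lambda>(x, y). (y, x)) = (lborel :: (real \<times> real) measure)"
    by (subst lborel_pair.distr_pair_swap[symmetric], rule lborel_prod)
  then have "AE p in distr (lborel \<Otimes>\<^sub>M lborel) (lborel \<Otimes>\<^sub>M lborel) (\<lambda>(x, y). (y, x)). P p"
    by (subst \<open>distr _ _ _ = _\<close>) (rule assms)
  then have "AE p in lborel \<Otimes>\<^sub>M lborel. P ((\<lambda>(x, y). (y, x)) p)"
    by (rule AE_distrD[rotated]) (rule measurable_pair_swap')
  then have "AE p in lborel. P ((\<lambda>(x, y). (y, x)) p)"
    by (subst (asm) lborel_prod)
  then show ?thesis by (simp add: prod.swap_def case_prod_unfold)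
qed

text \<open>Integrating out the coordinates \<open>i\<close> and \<open>j\<close> first reduces the
  claim to the planar null set; \<open>i \<noteq> j\<close> makes these two separate integrations.
  It serves each edge of the path.\<close>

lemma AE_lborel_pair_imp_PiM:
  fixes P :: "real \<times> real \<Rightarrow> bool"
  assumes "AE p in lborel. P p" and V: "finite V" "i \<in> V" "j \<in> V" "i \<noteq> j"
  shows "AE x in \<Pi>\<^sub>M i\<in>V. unit_leb. P (x i, x j)"
proof -
  obtain N where N: "\<And>p. p \<notin> N \<Longrightarrow> P p" "N \<in> null_sets (lborel :: (real \<times> real) measure)"
    using AE_E3[OF assms(1)] by auto
  have [measurable]: "N \<in> sets borel" using N(2) by (simp add: null_sets_def)
  have null: "(\<integral>\<^sup>+t. indicator N (t, s) \<partial>unit_leb) = 0" if "AE t in unit_leb. (t, s) \<notin> N" for s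
    using that by (subst nn_integral_0_iff_AE) (auto elim!: eventually_mono)
  \<comment> \<open>Coordinate \<open>i\<close> is integrated innermost, so null sections are needed
    with the second coordinate fixed; the swap puts the quantifiers in that order.\<close>
  have "AE p in lborel. prod.swap p \<notin> N"
    using AE_lborel_pair_swap[OF AE_not_in[OF N(2)]] .
  then have ae: "AE s in unit_leb. AE t in unit_leb. (t, s) \<notin> N"
    using AE_lborel_pair_imp_unit_leb[of "\<lambda>p. prod.swap p \<notin> N"] by simp
  define V' where "V' = V - {i, j}"
  have V': "V = insert i (insert j V')" "finite V'" "j \<notin> V'" "i \<notin> insert j V'"
    using V by (auto simp: V'_def)
  have meas: "(\<lambda>x. indicator N (x i, x j) :: ennreal) \<in> borel_measurable (\<Pi>\<^sub>M i\<in>insert i (insert j V'). unit_leb)"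
    by measurable
  have "(\<integral>\<^sup>+x. indicator N (x i, x j) \<partial>(\<Pi>\<^sub>M i\<in>V. unit_leb))
      = (\<integral>\<^sup>+x. (\<integral>\<^sup>+t. indicator N (t, x j) \<partial>unit_leb) \<partial>(\<Pi>\<^sub>M i\<in>insert j V'. unit_leb))"
    unfolding V'(1) using V' \<open>i \<noteq> j\<close>
    by (subst unit_cube.product_nn_integral_insert[OF _ _ meas]) auto
  also have "\<dots> = (\<integral>\<^sup>+x. (\<integral>\<^sup>+s. (\<integral>\<^sup>+t. indicator N (t, s) \<partial>unit_leb) \<partial>unit_leb) \<partial>(\<Pi>\<^sub>M i\<in>V'. unit_leb))"
    using V' by (subst unit_cube.product_nn_integral_insert) auto
  also have "(\<integral>\<^sup>+s. (\<integral>\<^sup>+t. indicator N (t, s) \<partial>unit_leb) \<partial>unit_leb) = (\<integral>\<^sup>+s. 0 \<partial>unit_leb)"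
    by (rule nn_integral_cong_AE, use ae in eventually_elim) (simp add: null)
  finally have "(\<integral>\<^sup>+x. indicator N (x i, x j) \<partial>(\<Pi>\<^sub>M i\<in>V. unit_leb)) = 0" by simp
  then have "AE x in \<Pi>\<^sub>M i\<in>V. unit_leb. (x i, x j) \<notin> N"
    using meas unfolding V'(1) by (subst (asm) nn_integral_0_iff_AE) (auto elim!: eventually_mono split: split_indicator_asm)
  then show ?thesis by eventually_elim (rule N)
qed

text \<open>Symmetry and bounds hold on the whole plane and measurability is jointly Borel, so
  sections and compositions with measurable functions are measurable without exceptional null
  sets.\<close>

definition borel_graphon :: "(real \<Rightarrow> real \<Rightarrow> real) \<Rightarrow> bool" where
  "borel_graphon K \<longleftrightarrow> (\<lambda>(x, y). K x y) \<in> borel_measurable (borel \<Otimes>\<^sub>M borel) \<and>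
     (\<forall>x y. K x y = K y x \<and> 0 \<le> K x y \<and> K x y \<le> 1)"

lemma graphon_borel_version:
  assumes "graphon W"
  obtains K where "borel_graphon K"
    "AE p in lborel. p \<in> {0..1} \<times> {0..1} \<longrightarrow> W (fst p) (snd p) = K (fst p) (snd p)"
proof -
  \<comment> \<open>Extension by zero turns \<open>W\<close> into a Lebesgue measurable function on
    the plane.\<close>
  define F where "F p = indicator ({0..1} \<times> {0..1}) p *\<^sub>R W (fst p) (snd p)" for p :: "real \<times> real"
  have sq: "{0..1} \<times> {0..1} \<in> sets (lebesgue :: (real \<times> real) measure)"
    by (intro sets_completionI_sets) (auto intro!: borel_closed closed_Times)
  have "F \<in> borel_measurable lebesgue"
    using assms sq unfolding F_def graphon_def
    by (auto simp: borel_measurable_restrict_space_iff case_prod_unfold)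
  then obtain F' where [measurable]: "F' \<in> borel_measurable borel"
    and F': "AE p in lborel. F p = F' p"
    using completion_ex_borel_measurable_real by fastforce
  have [measurable]: "F' \<in> borel_measurable (borel \<Otimes>\<^sub>M borel)"
    by (simp add: borel_prod)
  \<comment> \<open>Sorting the arguments forces symmetry and clamping forces the bounds; almost
    everywhere on the square this changes nothing, since \<open>W\<close> has both properties
    there.\<close>
  define K where "K x y = max 0 (min 1 (F' (min x y, max x y)))" for x y
  \<comment> \<open>For \<open>x > y\<close> the kernel \<open>K\<close> reads \<open>F'\<close> at
    the swapped point, so agreement is needed there as well.\<close>
  have "AE p in lborel. F (prod.swap p) = F' (prod.swap p)"
    by (rule AE_lborel_pair_swap[OF F'])
  then have "AE p in lborel. p \<in> {0..1} \<times> {0..1} \<longrightarrow> W (fst p) (snd p) = K (fst p) (snd p)"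
    using F'
  proof eventually_elim
    case (elim p)
    show ?case
    proof
      assume "p \<in> {0..1} \<times> {0..1}"
      then obtain x y where p: "p = (x, y)" "x \<in> {0..1}" "y \<in> {0..1}" by blast
      then have "W x y = W y x" "0 \<le> W x y" "W x y \<le> 1"
        using assms by (auto simp: graphon_def)
      with elim p show "W (fst p) (snd p) = K (fst p) (snd p)"
        by (cases "x \<le> y") (auto simp: F_def K_def min_def max_def)
    qed
  qed
  moreover have "borel_graphon K"
    unfolding borel_graphon_def
  proof (intro conjI allI)
    show "(\<lambda>(x, y). K x y) \<in> borel_measurable (borel \<Otimes>\<^sub>M borel)"
      unfolding K_def case_prod_unfold by measurable
    show "K x y = K y x" "0 \<le> K x y" "K x y \<le> 1" for x y
      by (simp_all add: K_def min.commute[of x] max.commute[of x])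
  qed
  ultimately show ?thesis using that by blast
qed


section \<open>Kernel operators\<close>

definition kernel_op :: "(real \<Rightarrow> real \<Rightarrow> real) \<Rightarrow> (real \<Rightarrow> real) \<Rightarrow> real \<Rightarrow> real" where
  "kernel_op K f x = (LINT y|unit_leb. K x y * f y)"

lemma borel_graphonD:
  assumes "borel_graphon K"
  shows "K x y = K y x" "0 \<le> K x y" "K x y \<le> 1"
  using assms by (auto simp: borel_graphon_def)

lemma borel_measurable_borel_graphon:
  assumes "borel_graphon K" and "f \<in> borel_measurable M" "g \<in> borel_measurable M"
  shows "(\<lambda>x. K (f x) (g x)) \<in> borel_measurable M"
  using measurable_compose[OF measurable_Pair[OF assms(2,3)], of "\<lambda>(x, y). K x y" borel] assms(1)
  by (simp add: borel_graphon_def)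

context
  fixes K :: "real \<Rightarrow> real \<Rightarrow> real"
  assumes K: "borel_graphon K"
begin

lemma abs_kernel_mult_le: "\<bar>K x y * c\<bar> \<le> \<bar>c\<bar>"
  using borel_graphonD[OF K, of x y] by (simp add: abs_mult mult_left_le_one_le)

lemma kernel_section_measurable: "K x \<in> borel_measurable unit_leb"
  using borel_measurable_borel_graphon[OF K, of "\<lambda>_. x" unit_leb "\<lambda>y. y"] by simp

lemma kernel_integrable:
  assumes "integrable unit_leb f"
  shows "integrable unit_leb (\<lambda>y. K x y * f y)"
proof (rule Bochner_Integration.integrable_bound[OF assms])
  show "(\<lambda>y. K x y * f y) \<in> borel_measurable unit_leb"
    using assms kernel_section_measurable by (intro borel_measurable_times) auto
qed (simp add: abs_kernel_mult_le)

lemma kernel_op_measurable: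
  assumes "f \<in> borel_measurable unit_leb"
  shows "kernel_op K f \<in> borel_measurable unit_leb"
proof -
  have "(\<lambda>p. K (fst p) (snd p)) \<in> borel_measurable (unit_leb \<Otimes>\<^sub>M unit_leb)"
    by (rule borel_measurable_borel_graphon[OF K measurable_compose[OF measurable_fst measurable_ident_unit_leb]
        measurable_compose[OF measurable_snd measurable_ident_unit_leb]])
  with assms show ?thesis
    unfolding kernel_op_def[abs_def]
    by (intro unit_leb.borel_measurable_lebesgue_integral) (simp add: case_prod_unfold)
qed

text \<open>As the kernel is at most 1, the integral of \<open>\<bar>f\<bar>\<close> bounds the
  image uniformly, which makes the image square-integrable on a finite measure.\<close>

lemma kernel_op_bound:
  assumes "integrable unit_leb f"
  shows "\<bar>kernel_op K f x\<bar> \<le> (LINT y|unit_leb. \<bar>f y\<bar>)"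
proof -
  have "\<bar>kernel_op K f x\<bar> \<le> (LINT y|unit_leb. \<bar>K x y * f y\<bar>)"
    unfolding kernel_op_def by (rule integral_abs_bound)
  also have "\<dots> \<le> (LINT y|unit_leb. \<bar>f y\<bar>)"
    using assms by (intro integral_mono integrable_abs kernel_integrable abs_kernel_mult_le)
  finally show ?thesis .
qed

lemma kernel_op_sq_integrable:
  assumes "sq_integrable f"
  shows "sq_integrable (kernel_op K f)"
  using assms kernel_op_bound[OF sq_integrable_imp_integrable[OF assms]]
  by (intro sq_integrable_bounded kernel_op_measurable) (auto simp: sq_integrable_def)

text \<open>Fubini exchanges the variables, and symmetry of \<open>K\<close> restores the order of
  its arguments.\<close>

lemma kernel_op_self_adjoint:
  assumes f: "sq_integrable f" and g: "sq_integrable g"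
  shows "(LINT x|unit_leb. f x * kernel_op K g x) = (LINT x|unit_leb. kernel_op K f x * g x)"
proof -
  have [measurable]: "f \<in> borel_measurable unit_leb" "g \<in> borel_measurable unit_leb"
    using f g by (auto simp: sq_integrable_def)
  have [measurable]: "(\<lambda>p. K (fst p) (snd p)) \<in> borel_measurable (unit_leb \<Otimes>\<^sub>M unit_leb)"
    by (rule borel_measurable_borel_graphon[OF K measurable_compose[OF measurable_fst measurable_ident_unit_leb]
        measurable_compose[OF measurable_snd measurable_ident_unit_leb]])
  define h where "h p = f (fst p) * (K (fst p) (snd p) * g (snd p))" for p
  have "integrable (unit_leb \<Otimes>\<^sub>M unit_leb) h"
  proof (rule unit_square.Fubini_integrable)
    show "h \<in> borel_measurable (unit_leb \<Otimes>\<^sub>M unit_leb)"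
      unfolding h_def[abs_def] by measurable
    \<comment> \<open>Since \<open>K\<close> is nonnegative, the inner integral of
      \<open>norm (h (x, y))\<close> is this product of two square-integrable functions.\<close>
    have "integrable unit_leb (\<lambda>x. \<bar>f x\<bar> * kernel_op K (\<lambda>y. \<bar>g y\<bar>) x)"
      by (intro sq_integrable_mult sq_integrable_abs kernel_op_sq_integrable f g)
    then show "integrable unit_leb (\<lambda>x. LINT y|unit_leb. norm (h (x, y)))"
      using borel_graphonD(2)[OF K] by (simp add: h_def abs_mult kernel_op_def)
    show "AE x in unit_leb. integrable unit_leb (\<lambda>y. h (x, y))"
      using kernel_integrable[OF sq_integrable_imp_integrable[OF g]] by (simp add: h_def)
  qed
  then have "(LINT y|unit_leb. LINT x|unit_leb. h (x, y)) = (LINT x|unit_leb. LINT y|unit_leb. h (x, y))"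
    by (intro unit_square.Fubini_integral) (simp add: case_prod_unfold)
  moreover have "(LINT y|unit_leb. h (x, y)) = f x * kernel_op K g x" for x
    by (simp add: h_def kernel_op_def)
  moreover have "(LINT x|unit_leb. h (x, y)) = kernel_op K f y * g y" for y
  proof -
    have "h (x, y) = K y x * f x * g y" for x
      using borel_graphonD(1)[OF K, of x y] by (simp add: h_def)
    then show ?thesis by (simp add: kernel_op_def)
  qed
  ultimately show ?thesis by simp
qed

end

section \<open>Test functions with values in the unit interval\<close>

lemma unit_funs_integrable:
  assumes "f \<in> unit_funs"
  shows "integrable unit_leb f"
  using assms
  by (intro unit_leb.integrable_const_bound[where B = 1] AE_I2) (auto simp: unit_funs_def)

lemma unit_funs_sq_integrable: "f \<in> unit_funs \<Longrightarrow> sq_integrable f"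
  by (rule sq_integrable_bounded[of f 1]) (auto simp: unit_funs_def)

lemma one_in_unit_funs: "(\<lambda>_. 1) \<in> unit_funs"
  by (simp add: unit_funs_def)

lemma norm_unit_funs_le:
  assumes "f \<in> unit_funs"
  shows "norm (l2_of f) \<le> 1"
proof -
  have "(LINT x|unit_leb. f x * f x) \<le> (LINT x|unit_leb. 1)"
    using assms by (intro integral_mono sq_integrable_mult unit_funs_sq_integrable)
      (auto simp: unit_funs_def intro: mult_le_one)
  then have "(norm (l2_of f))\<^sup>2 \<le> 1"
    using assms by (simp add: power2_norm_eq_inner inner_l2_of unit_funs_sq_integrable measure_def)
  then show ?thesis by (simp add: abs_square_le_1)
qed

text \<open>This keeps all iterates of 1 among the test functions over which the supremum is
  taken.\<close>

lemma kernel_op_unit_funs: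
  assumes "borel_graphon K" "f \<in> unit_funs"
  shows "kernel_op K f \<in> unit_funs"
proof -
  have f: "f y \<ge> 0" "f y \<le> 1" if "y \<in> {0..1}" for y
    using assms(2) that by (auto simp: unit_funs_def)
  have "0 \<le> kernel_op K f x" for x
    unfolding kernel_op_def using f borel_graphonD(2)[OF assms(1)]
    by (intro Bochner_Integration.integral_nonneg mult_nonneg_nonneg) simp_all
  moreover have "\<bar>kernel_op K f x\<bar> \<le> 1" for x
  proof -
    have "(LINT y|unit_leb. \<bar>f y\<bar>) \<le> (LINT y|unit_leb. 1)"
      using f unit_funs_integrable[OF assms(2)] by (intro integral_mono integrable_abs) auto
    then show ?thesis
      using kernel_op_bound[OF assms(1) unit_funs_integrable[OF assms(2)], of x]
      by (simp add: measure_def)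
  qed
  ultimately show ?thesis
    using kernel_op_measurable[OF assms(1)] assms(2) by (simp add: unit_funs_def)
qed

lemma kernel_op_funpow_unit_funs:
  assumes "borel_graphon K"
  shows "(kernel_op K ^^ n) (\<lambda>_. 1) \<in> unit_funs"
  by (induction n) (use assms in \<open>auto intro: kernel_op_unit_funs one_in_unit_funs\<close>)

text \<open>\<open>graphon_op\<close> integrates a chosen representative against \<open>W\<close>
  itself; for almost every \<open>x\<close>, the integrand agrees almost everywhere with the one
  built from \<open>K\<close> and \<open>h\<close>.\<close>

lemma graphon_op_eq_kernel_op:
  assumes K: "borel_graphon K"
    and ae: "AE p in lborel. p \<in> {0..1} \<times> {0..1} \<longrightarrow> W (fst p) (snd p) = K (fst p) (snd p)"
    and h: "sq_integrable h"
  shows "graphon_op W (l2_of h) = l2_of (kernel_op K h)"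
proof -
  define r where "r = rep_l2 (l2_of h)"
  have r: "AE y in unit_leb. r y = h y" "sq_integrable r"
    unfolding r_def using rep_l2_of_AE[OF h] by auto
  have [measurable]: "r \<in> borel_measurable unit_leb" "h \<in> borel_measurable unit_leb"
    using r h by (auto simp: sq_integrable_def)
  have [measurable]: "K x \<in> borel_measurable unit_leb" for x
    by (rule kernel_section_measurable[OF K])
  have "AE x in unit_leb. AE y in unit_leb. (x, y) \<in> {0..1} \<times> {0..1} \<longrightarrow> W x y = K x y"
    using AE_lborel_pair_imp_unit_leb[OF ae] by simp
  then have eq: "AE x in unit_leb. kernel_op K h x = (LINT y|unit_leb. W x y * r y)"
    using AE_space
  proof eventually_elim
    case (elim x)
    have ae_x: "AE y in unit_leb. K x y * h y = W x y * r y"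
      using elim(1) r(1) AE_space
    proof eventually_elim
      case (elim y)
      then show ?case using \<open>x \<in> space unit_leb\<close> by simp
    qed
    \<comment> \<open>Measurability comes from the Borel section by completeness.\<close>
    then have "(\<lambda>y. W x y * r y) \<in> borel_measurable unit_leb"
      by (rule unit_leb.measurable_cong_AE[rotated 2]) auto
    then show ?case
      unfolding kernel_op_def using ae_x by (intro integral_cong_AE) auto
  qed
  then show ?thesis
    unfolding graphon_op_def r_def[symmetric]
    using kernel_op_sq_integrable[OF K h] sq_integrable_cong_AE[OF _ eq]
    by (intro l2_of_eqI[symmetric])
qed

text \<open>\<open>z\<close> is an arbitrary class because it will be a value of \<open>S\<close>,
  which comes without an explicit representative.\<close>

lemma graphon_op_self_adjoint:
  assumes K: "borel_graphon K"
    and ae: "AE p in lborel. p \<in> {0..1} \<times> {0..1} \<longrightarrow> W (fst p) (snd p) = K (fst p) (snd p)"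
    and f: "sq_integrable f"
  shows "l2_of f \<bullet> graphon_op W z = l2_of (kernel_op K f) \<bullet> z"
proof -
  define h where "h = rep_l2 z"
  have h: "z = l2_of h" "sq_integrable h" by (simp_all add: h_def)
  show ?thesis
    unfolding h(1) graphon_op_eq_kernel_op[OF K ae h(2)]
    using kernel_op_self_adjoint[OF K f h(2)]
    by (simp add: inner_l2_of kernel_op_sq_integrable[OF K] f h(2))
qed


section \<open>Homomorphism densities of paths\<close>

lemma finite_measure_PiM_unit_leb:
  assumes "finite V"
  shows "finite_measure (\<Pi>\<^sub>M i\<in>V. unit_leb)"
proof (rule finite_measureI)
  have "emeasure (\<Pi>\<^sub>M i\<in>V. unit_leb) (\<Pi>\<^sub>E i\<in>V. space unit_leb) = (\<Prod>i\<in>V. emeasure unit_leb (space unit_leb))"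
    by (rule unit_cube.emeasure_PiM[OF assms]) (rule sets.top)
  then show "emeasure (\<Pi>\<^sub>M i\<in>V. unit_leb) (space (\<Pi>\<^sub>M i\<in>V. unit_leb)) \<noteq> \<infinity>"
    by (simp add: space_PiM)
qed

lemma component_measurable_PiM_unit_leb:
  assumes "i \<in> V"
  shows "(\<lambda>x. x i) \<in> borel_measurable (\<Pi>\<^sub>M i\<in>V. unit_leb)"
  using measurable_compose[OF measurable_component_singleton[OF assms] measurable_ident_unit_leb] .

lemma path_integrand_measurable:
  assumes "borel_graphon K" "set vs \<subseteq> V"
  shows "(\<lambda>x. \<Prod>i<length vs - 1. K (x (vs ! i)) (x (vs ! Suc i))) \<in> borel_measurable (\<Pi>\<^sub>M i\<in>V. unit_leb)"
  using assms(2)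
  by (intro borel_measurable_prod borel_measurable_borel_graphon[OF assms(1)]
      component_measurable_PiM_unit_leb) (auto intro!: nth_mem)

text \<open>Integrating out the first vertex \<open>v\<close> replaces the weight \<open>f\<close> on \<open>v\<close> by the weight
  \<open>kernel_op K f\<close> on the next vertex.\<close>

lemma integral_weighted_path:
  assumes K: "borel_graphon K" and "vs \<noteq> []" "distinct vs" "f \<in> unit_funs"
  shows "(LINT x|(\<Pi>\<^sub>M i\<in>set vs. unit_leb). f (x (hd vs)) * (\<Prod>i<length vs - 1. K (x (vs ! i)) (x (vs ! Suc i))))
    = (LINT t|unit_leb. (kernel_op K ^^ (length vs - 1)) f t)"
  using assms(2-)
proof (induction vs arbitrary: f)
  case (Cons v vs)
  have [measurable]: "f \<in> borel_measurable unit_leb"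
    using Cons.prems by (simp add: unit_funs_def)
  show ?case
  proof (cases "vs = []")
    case True
    then show ?thesis by (simp add: unit_cube.product_integral_singleton)
  next
    case False
    then obtain w ws where vs: "vs = w # ws" by (cases vs) auto
    have v: "v \<notin> set vs" "distinct vs" using Cons.prems by auto
    \<comment> \<open>The weight of the remaining edges: \<open>length ws\<close> is the number of
      edges of the tail \<open>vs\<close>. As \<open>v\<close> does not occur in \<open>vs\<close>,
      it is independent of \<open>x v\<close>.\<close>
    define G where "G x = (\<Prod>i<length ws. K (x (vs ! i)) (x (vs ! Suc i)))" for x
    have split: "(\<Prod>i<length (v # vs) - 1. K (x ((v # vs) ! i)) (x ((v # vs) ! Suc i)))
        = K (x v) (x w) * G x" for x
      by (simp add: vs G_def prod.lessThan_Suc_shift del: prod.lessThan_Suc)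
    have G_upd: "G (x(v := t)) = G x" for x t
      unfolding G_def
    proof (intro prod.cong refl)
      fix i assume "i \<in> {..<length ws}"
      then have "i < length vs" "Suc i < length vs" by (auto simp: vs)
      then have "vs ! i \<in> set vs" "vs ! Suc i \<in> set vs" by (simp_all only: nth_mem)
      then have "vs ! i \<noteq> v" "vs ! Suc i \<noteq> v" using v by auto
      then show "K ((x(v := t)) (vs ! i)) ((x(v := t)) (vs ! Suc i)) = K (x (vs ! i)) (x (vs ! Suc i))"
        by simp
    qed
    define M where "M = (\<Pi>\<^sub>M i\<in>insert v (set vs). unit_leb)"
    interpret M: finite_measure M
      unfolding M_def by (rule finite_measure_PiM_unit_leb) simp
    have f01: "0 \<le> f t" "f t \<le> 1" if "t \<in> {0..1}" for t
      using Cons.prems that by (auto simp: unit_funs_def)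
    have "integrable M (\<lambda>x. f (x v) * (K (x v) (x w) * G x))"
    proof (rule M.integrable_const_bound[where B = 1])
      have "(\<lambda>x. f (x v)) \<in> borel_measurable M"
        unfolding M_def by (rule measurable_compose[OF measurable_component_singleton]) auto
      moreover have "(\<lambda>x. K (x v) (x w)) \<in> borel_measurable M"
        unfolding M_def vs
        by (intro borel_measurable_borel_graphon[OF K] component_measurable_PiM_unit_leb) auto
      moreover have "G \<in> borel_measurable M"
        using path_integrand_measurable[OF K, of vs "insert v (set vs)"]
        unfolding M_def G_def[abs_def] by (auto simp: vs)
      ultimately show "(\<lambda>x. f (x v) * (K (x v) (x w) * G x)) \<in> borel_measurable M"
        by (intro borel_measurable_times)
      have "norm (f (x v) * (K (x v) (x w) * G x)) \<le> 1" if "x \<in> space M" for x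
      proof -
        have "x v \<in> {0..1}" using that by (auto simp: M_def space_PiM)
        moreover have "0 \<le> G x" "G x \<le> 1"
          unfolding G_def using borel_graphonD[OF K] by (auto intro!: prod_nonneg prod_le_1)
        ultimately show ?thesis
          using f01[of "x v"] borel_graphonD[OF K, of "x v" "x w"]
          by (simp add: abs_mult mult_le_one)
      qed
      then show "AE x in M. norm (f (x v) * (K (x v) (x w) * G x)) \<le> 1" by (rule AE_I2)
    qed
    then have "(LINT x|M. f (x v) * (K (x v) (x w) * G x))
        = (LINT x|(\<Pi>\<^sub>M i\<in>set vs. unit_leb). LINT t|unit_leb.
             f ((x(v := t)) v) * (K ((x(v := t)) v) ((x(v := t)) w) * G (x(v := t))))"
      unfolding M_def using v by (intro unit_cube.product_integral_insert) auto
    \<comment> \<open>By symmetry of \<open>K\<close>, integrating over \<open>t\<close> gives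
      \<open>kernel_op K f\<close> at \<open>x w\<close>, with \<open>G x\<close> a constant
      factor.\<close>
    also have "\<dots> = (LINT x|(\<Pi>\<^sub>M i\<in>set vs. unit_leb). kernel_op K f (x (hd vs)) * G x)"
    proof (intro Bochner_Integration.integral_cong refl)
      fix x
      have "(LINT t|unit_leb. f t * (K t (x w) * G x)) = (LINT t|unit_leb. K (x w) t * f t * G x)"
        by (intro Bochner_Integration.integral_cong refl) (simp add: borel_graphonD(1)[OF K, of _ "x w"])
      then show "(LINT t|unit_leb. f ((x(v := t)) v) * (K ((x(v := t)) v) ((x(v := t)) w) * G (x(v := t))))
          = kernel_op K f (x (hd vs)) * G x"
        using v by (auto simp: G_upd vs kernel_op_def)
    qed
    \<comment> \<open>The induction hypothesis is used with the new weight
      \<open>kernel_op K f\<close>, hence the generalisation over \<open>f\<close>.\<close>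
    also have "\<dots> = (LINT t|unit_leb. (kernel_op K ^^ (length vs - 1)) (kernel_op K f) t)"
      using Cons.IH[OF False v(2) kernel_op_unit_funs[OF K]] Cons.prems
      by (simp add: G_def vs)
    also have "(kernel_op K ^^ (length vs - 1)) (kernel_op K f) = (kernel_op K ^^ (length (v # vs) - 1)) f"
      by (simp add: vs funpow_swap1)
    finally show ?thesis unfolding split by (simp add: M_def)
  qed
qed simp

text \<open>The two orderings of the endpoints are the only candidates for \<open>THE\<close>;
  symmetry at this point makes their values equal.\<close>

lemma edge_weight_eq:
  assumes "i \<noteq> j" "W (x i) (x j) = W (x j) (x i)"
  shows "edge_weight W x {i, j} = W (x i) (x j)"
  unfolding edge_weight_def using assms by (intro the_equality) (auto simp: doubleton_eq_iff)

text \<open>Equal edges have equal indices, or crossed ones with \<open>i = Suc j\<close> and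
  \<open>Suc i = j\<close>, which is impossible. This turns products over edges into indexed
  products and yields \<open>card E\<close>.\<close>

lemma path_edges_bij:
  assumes "distinct vs"
  shows "bij_betw (\<lambda>i. {vs ! i, vs ! Suc i}) {..<length vs - 1} {{vs ! i, vs ! Suc i} |i. Suc i < length vs}"
proof (rule bij_betw_imageI)
  show "inj_on (\<lambda>i. {vs ! i, vs ! Suc i}) {..<length vs - 1}"
    using assms by (auto simp: inj_on_def doubleton_eq_iff nth_eq_iff_index_eq)
  show "(\<lambda>i. {vs ! i, vs ! Suc i}) ` {..<length vs - 1} = {{vs ! i, vs ! Suc i} |i. Suc i < length vs}"
    by auto
qed

text \<open>Trading \<open>W\<close> for \<open>K\<close> on every edge reduces the integral to
  \<open>integral_weighted_path\<close> with constant weight 1.\<close>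

lemma hom_density_path:
  assumes path: "path_graph V E" and W: "graphon W" and K: "borel_graphon K"
    and ae: "AE p in lborel. p \<in> {0..1} \<times> {0..1} \<longrightarrow> W (fst p) (snd p) = K (fst p) (snd p)"
  shows "hom_density V E W = (LINT t|unit_leb. (kernel_op K ^^ card E) (\<lambda>_. 1) t)"
proof -
  obtain vs where vs: "vs \<noteq> []" "distinct vs" "set vs = V"
    and E: "E = {{vs ! i, vs ! Suc i} | i. Suc i < length vs}"
    using path by (auto simp: path_graph_def)
  have bij: "bij_betw (\<lambda>i. {vs ! i, vs ! Suc i}) {..<length vs - 1} E"
    unfolding E by (rule path_edges_bij[OF vs(2)])
  have card: "card E = length vs - 1" using bij_betw_same_card[OF bij] by simp
  define M where "M = (\<Pi>\<^sub>M i\<in>V. unit_leb)"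
  define H where "H x = (\<Prod>i<length vs - 1. K (x (vs ! i)) (x (vs ! Suc i)))" for x
  have H: "H \<in> borel_measurable M"
    using path_integrand_measurable[OF K, of vs V] vs(3) unfolding M_def H_def[abs_def] by simp
  have idx: "vs ! i \<in> V" "vs ! Suc i \<in> V" "vs ! i \<noteq> vs ! Suc i" if "i < length vs - 1" for i
    using that vs by (auto simp: nth_eq_iff_index_eq)
  have "finite V" using vs(3) by auto
  \<comment> \<open>Each edge excludes one null set, and there are finitely many edges.\<close>
  then have "AE x in M. \<forall>i\<in>{..<length vs - 1}. (x (vs ! i), x (vs ! Suc i)) \<in> {0..1} \<times> {0..1} \<longrightarrow>
      W (x (vs ! i)) (x (vs ! Suc i)) = K (x (vs ! i)) (x (vs ! Suc i))"
    unfolding M_def using idx AE_lborel_pair_imp_PiM[OF ae \<open>finite V\<close>, unfolded fst_conv snd_conv]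
    by (intro AE_finite_allI) (blast | simp)+
  then have eq: "AE x in M. H x = (\<Prod>e\<in>E. edge_weight W x e)"
    using AE_space
  proof eventually_elim
    case (elim x)
    have "edge_weight W x {vs ! i, vs ! Suc i} = K (x (vs ! i)) (x (vs ! Suc i))"
      if i: "i < length vs - 1" for i
    proof -
      have x: "x (vs ! i) \<in> {0..1}" "x (vs ! Suc i) \<in> {0..1}"
        using elim(2) idx[OF i] by (auto simp: M_def space_PiM PiE_iff)
      then have "edge_weight W x {vs ! i, vs ! Suc i} = W (x (vs ! i)) (x (vs ! Suc i))"
        using W idx[OF i] by (intro edge_weight_eq) (auto simp: graphon_def)
      then show ?thesis using elim(1) i x by simp
    qed
    then have "(\<Prod>i<length vs - 1. edge_weight W x {vs ! i, vs ! Suc i}) = H x"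
      unfolding H_def by (intro prod.cong) auto
    then show ?case using prod.reindex_bij_betw[OF bij, of "edge_weight W x"] by simp
  qed
  have "hom_density V E W = (LINT x|completion M. (\<Prod>e\<in>E. edge_weight W x e))"
    by (simp add: hom_density_def M_def)
  also have "\<dots> = (LINT x|completion M. H x)"
  proof (rule integral_cong_AE)
    show "H \<in> borel_measurable (completion M)" using H by (rule measurable_completion)
    then show "(\<lambda>x. \<Prod>e\<in>E. edge_weight W x e) \<in> borel_measurable (completion M)"
      by (rule completion.measurable_cong_AE[OF _ _ AE_completion[OF eq]]) simp
    show "AE x in completion M. (\<Prod>e\<in>E. edge_weight W x e) = H x"
      using AE_completion[OF eq] by eventually_elim simp
  qed
  also have "\<dots> = (LINT x|M. H x)" by (rule integral_completion[OF H])
  also have "\<dots> = (LINT t|unit_leb. (kernel_op K ^^ (length vs - 1)) (\<lambda>_. 1) t)"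
    using integral_weighted_path[OF K vs(1,2) one_in_unit_funs] vs(3) by (simp add: M_def H_def)
  finally show ?thesis by (simp add: card)
qed

section \<open>Telescoping from one graphon to the other\<close>

theorem theorem26:
  fixes V :: "'v set" and E :: "'v set set"
    and U W :: "real \<Rightarrow> real \<Rightarrow> real"
    and S :: "l2 \<Rightarrow> l2"
  assumes "path_graph V E"
    and "graphon U" and "graphon W"
    and "bounded_linear S"
    and "S (l2_of (\<lambda>_. 1)) = l2_of (\<lambda>_. 1)"
    and "adjoint S (l2_of (\<lambda>_. 1)) = l2_of (\<lambda>_. 1)"
  shows "\<bar>hom_density V E U - hom_density V E W\<bar>
     \<le> real (card E) *
       (SUP (f, g) \<in> unit_funs \<times> unit_funs.
          \<bar>l2_of f \<bullet> (graphon_op U (S (l2_of g)) - S (graphon_op W (l2_of g)))\<bar>)"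
proof -
  obtain K where K: "borel_graphon K"
    "AE p in lborel. p \<in> {0..1} \<times> {0..1} \<longrightarrow> U (fst p) (snd p) = K (fst p) (snd p)"
    using graphon_borel_version[OF assms(2)] .
  obtain L where L: "borel_graphon L"
    "AE p in lborel. p \<in> {0..1} \<times> {0..1} \<longrightarrow> W (fst p) (snd p) = L (fst p) (snd p)"
    using graphon_borel_version[OF assms(3)] .
  obtain C where C: "norm (S z) \<le> norm z * C" for z
    using bounded_linear.bounded[OF assms(4)] by blast
  define \<Phi> where "\<Phi> = (\<lambda>(f, g). \<bar>l2_of f \<bullet> (graphon_op U (S (l2_of g)) - S (graphon_op W (l2_of g)))\<bar>)"
  \<comment> \<open>Self-adjointness moves the operator of \<open>U\<close> onto \<open>f\<close>,
    so only \<open>S\<close> separates the two arguments and the terms can telescope.\<close>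
  have \<Phi>: "\<Phi> (f, g) = \<bar>l2_of (kernel_op K f) \<bullet> S (l2_of g) - l2_of f \<bullet> S (l2_of (kernel_op L g))\<bar>"
    if "f \<in> unit_funs" "g \<in> unit_funs" for f g
    using that by (simp add: \<Phi>_def inner_diff_right graphon_op_self_adjoint[OF K]
        graphon_op_eq_kernel_op[OF L] unit_funs_sq_integrable)
  \<comment> \<open>The supremum of a real set controls its members only if the set is bounded
    above, so a uniform bound is needed; the sign of \<open>C\<close> is unknown, hence
    \<open>\<bar>C\<bar>\<close>.\<close>
  have inner_le: "\<bar>l2_of f \<bullet> S (l2_of g)\<bar> \<le> \<bar>C\<bar>" if "f \<in> unit_funs" "g \<in> unit_funs" for f g
  proof -
    have "norm (S (l2_of g)) \<le> norm (l2_of g) * \<bar>C\<bar>"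
      using C[of "l2_of g"] by (meson abs_ge_self mult_left_mono norm_ge_zero order_trans)
    also have "\<dots> \<le> 1 * \<bar>C\<bar>"
      by (intro mult_right_mono norm_unit_funs_le that) simp
    finally have "norm (l2_of f) * norm (S (l2_of g)) \<le> 1 * \<bar>C\<bar>"
      by (intro mult_mono norm_unit_funs_le that) auto
    then show ?thesis using Cauchy_Schwarz_ineq2[of "l2_of f" "S (l2_of g)"] by linarith
  qed
  have "\<Phi> p \<le> 2 * \<bar>C\<bar>" if fg: "p \<in> unit_funs \<times> unit_funs" for p
  proof -
    obtain f g where p: "p = (f, g)" "f \<in> unit_funs" "g \<in> unit_funs" using fg by blast
    then show ?thesis
      using inner_le[OF kernel_op_unit_funs[OF K(1) p(2)] p(3)]
        inner_le[OF p(2) kernel_op_unit_funs[OF L(1) p(3)]] by (simp add: \<Phi>)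
  qed
  then have bdd: "bdd_above (\<Phi> ` (unit_funs \<times> unit_funs))"
    by (intro bdd_aboveI2)
  define s where "s = Sup (\<Phi> ` (unit_funs \<times> unit_funs))"
  define a where "a n = (kernel_op K ^^ n) (\<lambda>_. 1)" for n
  define b where "b n = (kernel_op L ^^ n) (\<lambda>_. 1)" for n
  have a: "a n \<in> unit_funs" and b: "b n \<in> unit_funs" for n
    unfolding a_def b_def by (rule kernel_op_funpow_unit_funs[OF K(1)] kernel_op_funpow_unit_funs[OF L(1)])+
  have step: "\<bar>l2_of (a (Suc m)) \<bullet> S (l2_of (b n)) - l2_of (a m) \<bullet> S (l2_of (b (Suc n)))\<bar> \<le> s" for m n
  proof -
    have "\<Phi> (a m, b n) \<le> s"
      unfolding s_def using a b by (intro cSUP_upper bdd) auto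
    then show ?thesis
      unfolding \<Phi>[OF a b] by (simp add: a_def b_def)
  qed
  \<comment> \<open>Each step moves one kernel application from the left argument to the right one,
    so \<open>n\<close> must vary in the induction.\<close>
  have telescope: "\<bar>l2_of (a m) \<bullet> S (l2_of (b n)) - l2_of (a 0) \<bullet> S (l2_of (b (n + m)))\<bar> \<le> real m * s" for m n
  proof (induction m arbitrary: n)
    case (Suc m)
    show ?case using step[of m n] Suc[of "Suc n"] by (simp add: distrib_right)
  qed simp
  define k where "k = card E"
  have one: "sq_integrable (\<lambda>_. 1)" by (rule unit_funs_sq_integrable[OF one_in_unit_funs])
  have "hom_density V E U = l2_of (a k) \<bullet> l2_of (\<lambda>_. 1)"
    using hom_density_path[OF assms(1,2) K]
    by (simp add: inner_l2_of one unit_funs_sq_integrable[OF a]) (simp add: a_def k_def)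
  \<comment> \<open>\<open>b 0\<close> is the constant 1, which \<open>S\<close> fixes.\<close>
  then have U: "hom_density V E U = l2_of (a k) \<bullet> S (l2_of (b 0))"
    using assms(5) by (simp add: b_def)
  have "hom_density V E W = l2_of (b k) \<bullet> l2_of (\<lambda>_. 1)"
    using hom_density_path[OF assms(1,3) L]
    by (simp add: inner_l2_of one unit_funs_sq_integrable[OF b]) (simp add: b_def k_def)
  \<comment> \<open>The right-hand 1 is its own image under the adjoint, which passes to the left
    argument as \<open>S\<close>.\<close>
  also have "\<dots> = S (l2_of (b k)) \<bullet> l2_of (\<lambda>_. 1)"
    using bounded_linear_adjoint_works[OF assms(4), of "l2_of (b k)" "l2_of (\<lambda>_. 1)"] assms(6) by simp
  finally have W: "hom_density V E W = l2_of (a 0) \<bullet> S (l2_of (b k))"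
    by (simp add: a_def inner_commute)
  show ?thesis
    using telescope[of k 0] unfolding U W s_def \<Phi>_def k_def by simp
qed

end
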